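(* Let $L=(L,\le)$ be a finite lattice and let $W=\{\ell_1,\dots,\ell_k\}\subseteq L$ be a c-independent subset with witness $U=\{m_1,\dots,m_k\}$. If $\widetilde W=\{\tilde\ell_1,\dots,\tilde\ell_k\}\subseteq L$ is a push of $W$ with respect to $U$, then $\widetilde W$ is c-independent, with the same witness $U$.
   Context: The superboolean semiring is $\mathbb{SB}=\{0,1,1^\nu\}$ with commutative operations: $0+x=x$ for all $x$, $1+1=1+1^\nu=1^\nu+1^\nu=1^\nu$; $0\cdot x=0$, $1\cdot x=x$, $1^\nu\cdot 1^\nu=1^\nu$. Vectors $v_1,\dots,v_m\in\mathbb{SB}^{n}$ are dependent if there are $\alpha_1,\dots,\alpha_m\in\{0,1\}$, not all $0$, with $\alpha_1v_1+\cdots+\alpha_mv_m\in\{0,1^\nu\}^{n}$; otherwise they are independent. For a finite lattice $L$ let $D$ be the matrix over $\mathbb{SB}$ with rows and columns indexed by $L$, whose entry in row $m$ and column $\ell$ is $1$ if $\ell\not\le m$ and $0$ if $\ell\le m$. A subset $W\subseteq L$ is c-independent if the columns of $D$ indexed by $W$ are independent. A witness of a $k$-element subset $W\subseteq L$ is a $k$-element set $U\subseteq L$ such that the submatrix of $D$ with rows $U$ and columns $W$ is nonsingular, i.e. its permanent, computed in $\mathbb{SB}$, equals $1$. Equivalently, the elements can be indexed as $W=\{\ell_1,\dots,\ell_k\}$, $U=\{m_1,\dots,m_k\}$ so that $\ell_i\not\le m_i$ for all $i$ and $\ell_i\le m_j$ for all $i<j$; when a witness is listed as $m_1,\dots,m_k$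 together with $W=\{\ell_1,\dots,\ell_k\}$, such a matching indexing is meant. (A subset is c-independent iff it has a witness.) A push of $W=\{\ell_1,\dots,\ell_k\}$ with respect to its witness $U=\{m_1,\dots,m_k\}$ is a subset $\widetilde W=\{\tilde\ell_1,\dots,\tilde\ell_k\}\subseteq L$ with $\tilde\ell_i\le\ell_i$ and $\tilde\ell_i\not\le m_i$ for every $i=1,\dots,k$. *)

theory Defs
  imports "HOL-Analysis.Finite_Cartesian_Product" "HOL-Library.FuncSet"
begin

datatype superboolean = Zero | One | Nu

instantiation superboolean :: comm_semiring_1
begin

definition zero_superboolean :: superboolean where "0 = Zero"

definition one_superboolean :: superboolean where "1 = One"

fun plus_superboolean :: "superboolean \<Rightarrow> superboolean \<Rightarrow> superboolean" where
  "Zero + y = y"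
| "x + Zero = x"
| "x + y = Nu"

fun times_superboolean :: "superboolean \<Rightarrow> superboolean \<Rightarrow> superboolean" where
  "Zero * y = Zero"
| "x * Zero = Zero"
| "One * y = y"
| "x * One = x"
| "Nu * Nu = Nu"

instance
proof
  fix a b c :: superboolean
  show "a + b + c = a + (b + c)" by (cases a; cases b; cases c) simp_all
  show "a + b = b + a" by (cases a; cases b) simp_all
  show "0 + a = a" by (simp add: zero_superboolean_def)
  show "a * b * c = a * (b * c)" by (cases a; cases b; cases c) simp_all
  show "a * b = b * a" by (cases a; cases b) simp_all
  show "1 * a = a" by (cases a) (simp_all add: one_superboolean_def)
  show "(a + b) * c = a * c + b * c" by (cases a; cases b; cases c) simp_all
  show "0 * a = 0" by (simp add: zero_superboolean_def)
  show "a * 0 = 0" by (cases a) (simp_all add: zero_superboolean_def)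
  show "(0 :: superboolean) \<noteq> 1" by (simp add: zero_superboolean_def one_superboolean_def)
qed

end

definition sb_dependent :: "'i set \<Rightarrow> ('i \<Rightarrow> superboolean ^ 'n) \<Rightarrow> bool" where
  "sb_dependent I v \<longleftrightarrow>
     (\<exists>\<alpha>. (\<forall>i\<in>I. \<alpha> i \<in> {0, 1}) \<and> (\<exists>i\<in>I. \<alpha> i \<noteq> 0) \<and>
          (\<forall>r. (\<Sum>i\<in>I. \<alpha> i *s v i) $ r \<in> {0, Nu}))"

abbreviation sb_independent :: "'i set \<Rightarrow> ('i \<Rightarrow> superboolean ^ 'n) \<Rightarrow> bool" where
  "sb_independent I v \<equiv> \<not> sb_dependent I v"

(* The row index comes first: D $ m $ l is the entry in row m and column l. *)
definition D :: "((superboolean, 'a :: {finite, lattice}) vec, 'a) vec" where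
  "D = (\<chi> m l. if l \<le> m then 0 else 1)"

definition c_independent :: "('a :: {finite, lattice}) set \<Rightarrow> bool" where
  "c_independent W \<longleftrightarrow> sb_independent W (\<lambda>l. column l D)"

(* The permanent of the submatrix with rows U and columns W, meant for card U = card W.
   Bijections are taken extensional so that each one is counted exactly once. *)
definition permanent ::
  "'m set \<Rightarrow> 'n set \<Rightarrow> superboolean ^ 'n ^ 'm \<Rightarrow> superboolean" where
  "permanent U W A =
     (\<Sum>\<sigma> | \<sigma> \<in> W \<rightarrow>\<^sub>E U \<and> bij_betw \<sigma> W U. \<Prod>l\<in>W. A $ \<sigma> l $ l)"

definition is_witness :: "('a :: {finite, lattice}) set \<Rightarrow> 'a set \<Rightarrow> bool" where
  "is_witness U W \<longleftrightarrow> card U = card W \<and> permanent U W D = 1"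

definition matching_indexing ::
  "nat \<Rightarrow> (nat \<Rightarrow> 'a :: {finite, lattice}) \<Rightarrow> (nat \<Rightarrow> 'a) \<Rightarrow> 'a set \<Rightarrow> 'a set \<Rightarrow> bool" where
  "matching_indexing k l m W U \<longleftrightarrow>
     bij_betw l {1..k} W \<and> bij_betw m {1..k} U \<and>
     (\<forall>i\<in>{1..k}. \<not> l i \<le> m i) \<and>
     (\<forall>i\<in>{1..k}. \<forall>j\<in>{1..k}. i < j \<longrightarrow> l i \<le> m j)"

(* W' = {l' 1, ..., l' k} is a push of {l 1, ..., l k} with respect to {m 1, ..., m k}.
   The l' i are not required to be pairwise distinct. *)
definition is_push ::
  "nat \<Rightarrow> (nat \<Rightarrow> 'a :: {finite, lattice}) \<Rightarrow> (nat \<Rightarrow> 'a) \<Rightarrow> (nat \<Rightarrow> 'a) \<Rightarrow> 'a set \<Rightarrow> bool" where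
  "is_push k l m l' W' \<longleftrightarrow>
     W' = l' ` {1..k} \<and> (\<forall>i\<in>{1..k}. l' i \<le> l i \<and> \<not> l' i \<le> m i)"

end

theory Submission
  imports Defs
begin

text \<open>A matching indexing says that the submatrix of \<^const>\<open>D\<close> with rows \<open>m 1, \<dots>, m k\<close> and
  columns \<open>l 1, \<dots>, l k\<close> is triangular, with ones on the diagonal and zeros below it.
  Such a matrix has permanent \<open>1\<close>, because the diagonal is the only transversal
  avoiding the zeros, and its columns are independent, because the last column with a nonzero
  coefficient contributes the only nonzero summand to its diagonal row. So a matching indexing
  alone yields both a witness and independence.

  It remains to see that a push keeps the triangular shape. Lowering \<open>l i\<close> to \<open>l' i\<close> keeps the
  zeros, as \<open>l' i \<le> l i \<le> m j\<close> for \<open>i < j\<close>, and the definition of a push keeps the ones on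
  the diagonal. The pushed elements do not collapse: for \<open>i < j\<close>, row \<open>m j\<close> separates
  \<open>l' i\<close> from \<open>l' j\<close>.\<close>

lemma D_entry: "D $ m $ l = (if l \<le> m then 0 else 1)"
  by (simp add: D_def)

lemma matching_indexing_push:
  assumes "matching_indexing k l m W U" and "is_push k l m l' W'"
  shows "matching_indexing k l' m W' U"
proof -
  have zero: "l' i \<le> m j" if "i \<in> {1..k}" "j \<in> {1..k}" "i < j" for i j
    using assms that unfolding matching_indexing_def is_push_def by (meson order_trans)
  have diag: "\<not> l' i \<le> m i" if "i \<in> {1..k}" for i
    using assms(2) that unfolding is_push_def by blast
  have "inj_on l' {1..k}"
    by (rule linorder_inj_onI) (use zero diag in \<open>metis linear\<close>)+
  then have "bij_betw l' {1..k} W'"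
    using assms(2) unfolding is_push_def by (simp add: bij_betw_def)
  then show ?thesis
    using assms(1) zero diag unfolding matching_indexing_def by blast
qed

text \<open>In a triangular matrix the diagonal is the only transversal without zeros: such a
  transversal takes column \<open>l i\<close> to some row \<open>m j\<close> with \<open>j \<le> i\<close>, and the rows with
  \<open>j < i\<close> are already used by the preceding columns.\<close>

lemma matching_indexing_transversal_unique:
  assumes "matching_indexing k l m W U" and "bij_betw \<sigma> W U"
    and nz: "\<And>x. x \<in> W \<Longrightarrow> \<not> x \<le> \<sigma> x"
    and "i \<in> {1..k}"
  shows "\<sigma> (l i) = m i"
  using \<open>i \<in> {1..k}\<close>
proof (induction i rule: less_induct)
  case (less i)
  have bl: "bij_betw l {1..k} W" and bm: "bij_betw m {1..k} U"
    and zero: "\<And>i j. i \<in> {1..k} \<Longrightarrow> j \<in> {1..k} \<Longrightarrow> i < j \<Longrightarrow> l i \<le> m j"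
    using assms(1) unfolding matching_indexing_def by blast+
  have liW: "l i \<in> W"
    using bl less.prems by (rule bij_betwE[rule_format])
  then have "\<sigma> (l i) \<in> U"
    using assms(2) bij_betwE by blast
  then obtain j where j: "j \<in> {1..k}" "\<sigma> (l i) = m j"
    using bm by (metis bij_betw_imp_surj_on imageE)
  have "j \<le> i"
    using zero[OF less.prems j(1)] nz[OF liW] j(2) by (metis not_le)
  moreover have "\<not> j < i"
  proof
    assume "j < i"
    then have "\<sigma> (l j) = \<sigma> (l i)"
      using less.IH j by simp
    moreover have "l j \<in> W"
      using bl j(1) bij_betwE by blast
    ultimately have "l j = l i"
      using assms(2) liW by (meson bij_betw_imp_inj_on inj_onD)
    then have "j = i"
      using bl j(1) less.prems by (meson bij_betw_imp_inj_on inj_onD)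
    with \<open>j < i\<close> show False by simp
  qed
  ultimately show ?case
    using j(2) by simp
qed

lemma matching_indexing_imp_is_witness:
  assumes "matching_indexing k l m W U"
  shows "is_witness U W"
proof -
  have bl: "bij_betw l {1..k} W" and bm: "bij_betw m {1..k} U"
    and diag: "\<And>i. i \<in> {1..k} \<Longrightarrow> \<not> l i \<le> m i"
    using assms unfolding matching_indexing_def by blast+
  have W: "\<exists>i\<in>{1..k}. x = l i" if "x \<in> W" for x
    using bl that by (metis bij_betw_imp_surj_on imageE)
  have card: "card U = card W"
    using bl bm bij_betw_same_card by metis
  define \<tau> where "\<tau> = restrict (m \<circ> the_inv_into {1..k} l) W"
  have \<tau>: "\<tau> (l i) = m i" if "i \<in> {1..k}" for i
    using bl that unfolding \<tau>_def
    by (simp add: bij_betwE bij_betw_imp_inj_on the_inv_into_f_f)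
  have \<tau>bij: "bij_betw \<tau> W U"
    unfolding \<tau>_def using bij_betw_trans[OF bij_betw_the_inv_into[OF bl] bm]
    by (simp cong: bij_betw_cong)
  have \<tau>ext: "\<tau> \<in> W \<rightarrow>\<^sub>E U"
    using bij_betwE[OF \<tau>bij] by (auto simp: \<tau>_def PiE_def)
  let ?S = "{\<sigma>. \<sigma> \<in> W \<rightarrow>\<^sub>E U \<and> bij_betw \<sigma> W U}"
  have fin: "finite ?S"
    by (rule finite_subset[of _ "W \<rightarrow>\<^sub>E U"]) (auto intro: finite_PiE)
  have off: "(\<Prod>x\<in>W. D $ \<sigma> x $ x) = 0" if "\<sigma> \<in> ?S - {\<tau>}" for \<sigma>
  proof -
    have "\<exists>x\<in>W. x \<le> \<sigma> x"
    proof (rule ccontr)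
      assume "\<not> (\<exists>x\<in>W. x \<le> \<sigma> x)"
      then have "\<sigma> (l i) = \<tau> (l i)" if "i \<in> {1..k}" for i
        using matching_indexing_transversal_unique[OF assms, of \<sigma> i] \<open>\<sigma> \<in> ?S - {\<tau>}\<close> that \<tau>
        by auto
      then have "\<sigma> x = \<tau> x" if "x \<in> W" for x
        using W that by blast
      then have "\<sigma> = \<tau>"
        using that \<tau>ext by (auto intro: PiE_ext)
      with that show False by simp
    qed
    then show ?thesis
      by (intro prod_zero) (auto simp: D_entry)
  qed
  have "permanent U W D = (\<Prod>x\<in>W. D $ \<tau> x $ x) + (\<Sum>\<sigma>\<in>?S - {\<tau>}. \<Prod>x\<in>W. D $ \<sigma> x $ x)"
    unfolding permanent_def using fin \<tau>bij \<tau>ext by (intro sum.remove) auto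
  also have "(\<Sum>\<sigma>\<in>?S - {\<tau>}. \<Prod>x\<in>W. D $ \<sigma> x $ x) = 0"
    using off by (rule sum.neutral[OF ballI])
  also have "(\<Prod>x\<in>W. D $ \<tau> x $ x) = 1"
    using W \<tau> diag by (intro prod.neutral) (metis D_entry)
  finally show ?thesis
    unfolding is_witness_def using card by simp
qed

lemma matching_indexing_imp_c_independent:
  assumes "matching_indexing k l m W U"
  shows "c_independent W"
  unfolding c_independent_def
proof
  assume "sb_dependent W (\<lambda>x. column x D)"
  then obtain \<alpha> where \<alpha>01: "\<And>x. x \<in> W \<Longrightarrow> \<alpha> x \<in> {0, 1}" and \<alpha>nz: "\<exists>x\<in>W. \<alpha> x \<noteq> 0"
    and ghost: "\<And>r. (\<Sum>x\<in>W. \<alpha> x *s column x D) $ r \<in> {0, Nu}"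
    unfolding sb_dependent_def by blast
  have bl: "bij_betw l {1..k} W"
    and diag: "\<And>i. i \<in> {1..k} \<Longrightarrow> \<not> l i \<le> m i"
    and zero: "\<And>i j. i \<in> {1..k} \<Longrightarrow> j \<in> {1..k} \<Longrightarrow> i < j \<Longrightarrow> l i \<le> m j"
    using assms unfolding matching_indexing_def by blast+
  let ?I = "{i \<in> {1..k}. \<alpha> (l i) \<noteq> 0}"
  define j where "j = Max ?I"
  have "?I \<noteq> {}"
    using \<alpha>nz bl by (force simp: bij_betw_def)
  then have jI: "j \<in> ?I"
    unfolding j_def by (intro Max_in) auto
  have jmax: "\<alpha> (l i) = 0" if "i \<in> {1..k}" "j < i" for i
    using that Max_ge[of ?I i] unfolding j_def by fastforce
  have "l j \<in> W"
    using bl jI bij_betwE by blast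
  then have aj: "\<alpha> (l j) = 1"
    using \<alpha>01 jI by blast
  \<comment> \<open>In row \<open>m j\<close>, columns before \<open>l j\<close> have entry zero and those after it have coefficient zero.\<close>
  have "(\<Sum>x\<in>W. \<alpha> x *s column x D) $ m j = (\<Sum>x\<in>W. \<alpha> x * D $ m j $ x)"
    by (simp add: column_def)
  also have "\<dots> = (\<Sum>i\<in>{1..k}. \<alpha> (l i) * D $ m j $ l i)"
    using bl by (rule sum.reindex_bij_betw[symmetric])
  also have "\<dots> = (\<Sum>i\<in>{1..k}. if i = j then 1 else 0)"
  proof (rule sum.cong[OF refl])
    fix i assume i: "i \<in> {1..k}"
    consider "i < j" | "i = j" | "j < i" by linarith
    then show "\<alpha> (l i) * D $ m j $ l i = (if i = j then 1 else 0)"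
      using i jI zero diag jmax aj by cases (auto simp: D_entry)
  qed
  also have "\<dots> = 1"
    using jI by simp
  finally show False
    using ghost[of "m j"] by (simp add: one_superboolean_def zero_superboolean_def)
qed

theorem proposition4p8:
  fixes W U W' :: "'a :: {finite, lattice} set"
    and l m l' :: "nat \<Rightarrow> 'a"
    and k :: nat
  assumes "c_independent W"
    and "is_witness U W"
    and "matching_indexing k l m W U"
    and "is_push k l m l' W'"
  shows "c_independent W' \<and> is_witness U W' \<and> matching_indexing k l' m W' U"
  using matching_indexing_push[OF assms(3,4)] matching_indexing_imp_is_witness
    matching_indexing_imp_c_independent by blast

end
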